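(* Let $d\ge1$ and let $(\mathbb Z^d,E,\mu,w)$ be the weighted nearest-neighbour lattice graph with vertex measure $\mu(x)=\sum_{y\sim x}w_{xy}$, satisfying $0<\mu_{\min}\le\mu_{\max}<\infty$ and $\inf_{x\sim y}w_{xy}>0$, with normalized Laplacian $\Delta$ and heat kernel $p(t,x,y)$. For $u\in\ell^2(\mathbb Z^d)$ and $x\in\mathbb Z^d$ let $$\nabla^{\log}u(x)=\Bigl(\sqrt{\tfrac{W_{\log}(x,y_i)}{2\mu(x)}}\,\bigl(u(x)-u(y_i)\bigr)\Bigr)_{i\ge1},\qquad W_{\log}(x,y)=\mu(x)\mu(y)\int_0^1p(t,x,y)\frac{dt}{t},$$ where $(y_i)_{i\ge1}$ enumerates $\mathbb Z^d\setminus\{x\}$. Then there exists a constant $C>0$, independent of $u$, such that $$\|\nabla^{\log}u\|_{\ell^2(\mathbb Z^d)}\le C\,\|u\|_{\ell^2(\mathbb Z^d)}\qquad\text{for all }u\in\ell^2(\mathbb Z^d).$$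
   Context: Weighted lattice graph: vertex set $\mathbb Z^d$, with $x\sim y$ iff $|x-y|_1=1$; symmetric weights $w_{xy}=w_{yx}>0$ if $x\sim y$ and $w_{xy}=0$ otherwise (in particular $w_{xx}=0$); $\mu(x)=\sum_{y\sim x}w_{xy}$; $\mu_{\min}=\inf_x\mu(x)$, $\mu_{\max}=\sup_x\mu(x)$. The normalized Laplacian is $\Delta u(x)=\frac1{\mu(x)}\sum_{y\sim x}w_{xy}(u(y)-u(x))$, a bounded self-adjoint operator on $\ell^2(\mathbb Z^d,\mu)$. The heat kernel $p(t,x,y)$, $t\ge0$, is defined by $e^{t\Delta}u(x)=\sum_{y}p(t,x,y)u(y)\mu(y)$, i.e. $p(t,x,y)=\mu(y)^{-1}(e^{t\Delta}\mathbf 1_{\{y\}})(x)$. Norms: $\|u\|_{\ell^2(\mathbb Z^d)}^2=\sum_x|u(x)|^2\mu(x)$, and $\|\nabla^{\log}u\|^2_{\ell^2(\mathbb Z^d)}=\sum_x|\nabla^{\log}u(x)|^2\mu(x)$ with $|\nabla^{\log}u(x)|^2=\sum_{y\ne x}\frac{W_{\log}(x,y)}{2\mu(x)}|u(x)-u(y)|^2$. *)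

theory Defs
  imports "HOL-Analysis.Analysis"
begin

definition lattice_adj :: "int ^ 'd::finite \<Rightarrow> int ^ 'd \<Rightarrow> bool" where
  "lattice_adj x y \<longleftrightarrow> (\<Sum>i\<in>UNIV. \<bar>x $ i - y $ i\<bar>) = 1"

definition weighted_lattice :: "(int ^ 'd::finite \<Rightarrow> int ^ 'd \<Rightarrow> real) \<Rightarrow> bool" where
  "weighted_lattice w \<longleftrightarrow>
     (\<forall>x y. w x y = w y x) \<and>
     (\<forall>x y. lattice_adj x y \<longrightarrow> w x y > 0) \<and>
     (\<forall>x y. \<not> lattice_adj x y \<longrightarrow> w x y = 0)"

definition vertex_measure :: "(int ^ 'd::finite \<Rightarrow> int ^ 'd \<Rightarrow> real) \<Rightarrow> int ^ 'd \<Rightarrow> real" where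
  "vertex_measure w x = (\<Sum>y | lattice_adj x y. w x y)"

text \<open>Extended reals, so that the supremum of an unbounded measure is infinite.\<close>

definition mu_min :: "(int ^ 'd::finite \<Rightarrow> int ^ 'd \<Rightarrow> real) \<Rightarrow> ereal" where
  "mu_min w = (INF x. ereal (vertex_measure w x))"

definition mu_max :: "(int ^ 'd::finite \<Rightarrow> int ^ 'd \<Rightarrow> real) \<Rightarrow> ereal" where
  "mu_max w = (SUP x. ereal (vertex_measure w x))"

definition weight_inf :: "(int ^ 'd::finite \<Rightarrow> int ^ 'd \<Rightarrow> real) \<Rightarrow> ereal" where
  "weight_inf w = (INF (x, y) \<in> {(x, y). lattice_adj x y}. ereal (w x y))"

definition l2 :: "(int ^ 'd::finite \<Rightarrow> int ^ 'd \<Rightarrow> real) \<Rightarrow> (int ^ 'd \<Rightarrow> 'a::real_normed_vector) \<Rightarrow> bool" where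
  "l2 w u \<longleftrightarrow> (\<lambda>x. (norm (u x))\<^sup>2 * vertex_measure w x) summable_on UNIV"

definition l2_norm :: "(int ^ 'd::finite \<Rightarrow> int ^ 'd \<Rightarrow> real) \<Rightarrow> (int ^ 'd \<Rightarrow> 'a::real_normed_vector) \<Rightarrow> real" where
  "l2_norm w u = sqrt (\<Sum>\<^sub>\<infinity>x. (norm (u x))\<^sup>2 * vertex_measure w x)"

definition laplacian ::
    "(int ^ 'd::finite \<Rightarrow> int ^ 'd \<Rightarrow> real) \<Rightarrow> (int ^ 'd \<Rightarrow> 'a::real_normed_vector) \<Rightarrow> int ^ 'd \<Rightarrow> 'a" where
  "laplacian w u x = (1 / vertex_measure w x) *\<^sub>R (\<Sum>y | lattice_adj x y. w x y *\<^sub>R (u y - u x))"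

text \<open>The partial sums of the exponential series of the operator \<open>t\<Delta>\<close>, applied to \<open>u\<close>.\<close>

definition exp_partial ::
    "(int ^ 'd::finite \<Rightarrow> int ^ 'd \<Rightarrow> real) \<Rightarrow> real \<Rightarrow> (int ^ 'd \<Rightarrow> 'a::real_normed_vector) \<Rightarrow> nat \<Rightarrow> int ^ 'd \<Rightarrow> 'a" where
  "exp_partial w t u N x = (\<Sum>n<N. (t ^ n / fact n) *\<^sub>R (laplacian w ^^ n) u x)"

text \<open>
  \<open>e\<^sup>t\<^sup>\<Delta> u\<close> is the limit of the exponential series in the norm of \<open>\<ell>\<^sup>2(\<int>\<^sup>d, \<mu>)\<close>. Square summability of
  the differences is required explicitly because \<^const>\<open>l2_norm\<close> is \<open>0\<close> on functions that are not
  square summable.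
\<close>

definition heat_semigroup ::
    "(int ^ 'd::finite \<Rightarrow> int ^ 'd \<Rightarrow> real) \<Rightarrow> real \<Rightarrow> (int ^ 'd \<Rightarrow> 'a::real_normed_vector) \<Rightarrow> int ^ 'd \<Rightarrow> 'a" where
  "heat_semigroup w t u = (THE v. l2 w v \<and>
     (\<forall>N. l2 w (\<lambda>x. exp_partial w t u N x - v x)) \<and>
     (\<lambda>N. l2_norm w (\<lambda>x. exp_partial w t u N x - v x)) \<longlonglongrightarrow> 0)"

definition heat_kernel ::
    "(int ^ 'd::finite \<Rightarrow> int ^ 'd \<Rightarrow> real) \<Rightarrow> real \<Rightarrow> int ^ 'd \<Rightarrow> int ^ 'd \<Rightarrow> real" where
  "heat_kernel w t x y = heat_semigroup w t (indicator {y}) x / vertex_measure w y"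

text \<open>The integral diverges for \<open>x = y\<close>, where the Bochner integral is \<open>0\<close>; only off-diagonal values are used.\<close>

definition W_log ::
    "(int ^ 'd::finite \<Rightarrow> int ^ 'd \<Rightarrow> real) \<Rightarrow> int ^ 'd \<Rightarrow> int ^ 'd \<Rightarrow> real" where
  "W_log w x y = vertex_measure w x * vertex_measure w y *
     (LINT t:{0<..1}|lborel. heat_kernel w t x y / t)"

text \<open>
  The entries of the vector \<open>\<nabla>\<^sup>l\<^sup>o\<^sup>g u(x)\<close> are indexed by the vertices \<open>y \<noteq> x\<close> themselves instead of by an
  enumeration of them.
\<close>

definition grad_log ::
    "(int ^ 'd::finite \<Rightarrow> int ^ 'd \<Rightarrow> real) \<Rightarrow> (int ^ 'd \<Rightarrow> 'a::real_normed_vector) \<Rightarrow> int ^ 'd \<Rightarrow> int ^ 'd \<Rightarrow> 'a" where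
  "grad_log w u x y = sqrt (W_log w x y / (2 * vertex_measure w x)) *\<^sub>R (u x - u y)"

definition grad_log_length ::
    "(int ^ 'd::finite \<Rightarrow> int ^ 'd \<Rightarrow> real) \<Rightarrow> (int ^ 'd \<Rightarrow> 'a::real_normed_vector) \<Rightarrow> int ^ 'd \<Rightarrow> real" where
  "grad_log_length w u x = sqrt (\<Sum>\<^sub>\<infinity>y\<in>-{x}. (norm (grad_log w u x y))\<^sup>2)"

text \<open>
  Membership of \<open>\<nabla>\<^sup>l\<^sup>o\<^sup>g u\<close> in \<open>\<ell>\<^sup>2\<close>, i.e. finiteness of its norm: both infinite sums in the norm converge.
\<close>

definition grad_log_l2 ::
    "(int ^ 'd::finite \<Rightarrow> int ^ 'd \<Rightarrow> real) \<Rightarrow> (int ^ 'd \<Rightarrow> 'a::real_normed_vector) \<Rightarrow> bool" where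
  "grad_log_l2 w u \<longleftrightarrow>
     (\<forall>x. (\<lambda>y. (norm (grad_log w u x y))\<^sup>2) summable_on -{x}) \<and> l2 w (grad_log_length w u)"

text \<open>
  The remaining lemmas only show that the definite description in \<^const>\<open>heat_semigroup\<close> and the integral in
  \<^const>\<open>W_log\<close> do not take default values where they are used: the exponential series applied to
  the indicator of \<open>{y}\<close> converges in \<open>\<ell>\<^sup>2\<close> to the pointwise sum, and \<open>p(t,x,y)/t\<close> is integrable on \<open>(0,1]\<close> for \<open>x \<noteq> y\<close>.
\<close>

lemma finite_neighbours: "finite {y :: int ^ 'd::finite. lattice_adj x y}"
proof -
  have "y \<in> vec_lambda ` PiE UNIV (\<lambda>i. {x $ i - 1..x $ i + 1})" if "lattice_adj x y" for y
  proof -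
    have "\<bar>x $ i - y $ i\<bar> \<le> (\<Sum>i\<in>UNIV. \<bar>x $ i - y $ i\<bar>)" for i
      by (rule member_le_sum) auto
    then have "\<bar>x $ i - y $ i\<bar> \<le> 1" for i
      using that by (simp add: lattice_adj_def)
    then have "y $ i \<in> {x $ i - 1..x $ i + 1}" for i
      by (smt (verit) atLeastAtMost_iff)
    then have "(\<lambda>i. y $ i) \<in> PiE UNIV (\<lambda>i. {x $ i - 1..x $ i + 1})"
      by auto
    then show ?thesis
      by (intro image_eqI[of _ _ "\<lambda>i. y $ i"]) (simp add: vec_nth_inverse)
  qed
  moreover have "finite (vec_lambda ` PiE UNIV (\<lambda>i. {x $ i - 1..x $ i + 1}))"
    by (intro finite_imageI finite_PiE) auto
  ultimately show ?thesis
    by (elim finite_subset[rotated]) (intro subsetI, simp)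
qed

lemma weight_nonneg: "weighted_lattice w \<Longrightarrow> w x y \<ge> 0"
  unfolding weighted_lattice_def by (metis less_eq_real_def)

lemma vertex_measure_pos:
  assumes "weighted_lattice w" shows "vertex_measure w x > 0"
proof -
  fix i0 :: 'a
  have "(\<Sum>i\<in>UNIV. \<bar>x $ i - (x + axis i0 1) $ i\<bar>) = (\<Sum>i\<in>UNIV. if i = i0 then 1 else 0)"
    by (rule sum.cong) (auto simp: axis_def)
  then have "x + axis i0 1 \<in> {y. lattice_adj x y}"
    by (simp add: lattice_adj_def)
  then show ?thesis unfolding vertex_measure_def
    using assms finite_neighbours unfolding weighted_lattice_def by (intro sum_pos) blast+
qed

lemma sum_weight_le:
  assumes w: "weighted_lattice w" and "finite F"
  shows "(\<Sum>y\<in>F. w x y) \<le> vertex_measure w x"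
proof -
  have "(\<Sum>y\<in>F. w x y) \<le> (\<Sum>y\<in>F \<union> {y. lattice_adj x y}. w x y)"
    using assms finite_neighbours weight_nonneg[OF w] by (intro sum_mono2) auto
  also have "\<dots> = vertex_measure w x"
    unfolding vertex_measure_def
    using assms finite_neighbours unfolding weighted_lattice_def by (intro sum.mono_neutral_right) blast+
  finally show ?thesis .
qed

lemma laplacian_l1:
  fixes f :: "int ^ 'd::finite \<Rightarrow> real"
  assumes w: "weighted_lattice w" and K: "\<And>F. finite F \<Longrightarrow> (\<Sum>x\<in>F. \<bar>f x\<bar> * vertex_measure w x) \<le> K"
    and F: "finite F"
  shows "(\<Sum>x\<in>F. \<bar>laplacian w f x\<bar> * vertex_measure w x) \<le> 2 * K"
proof -
  note pos = vertex_measure_pos[OF w] and nn = weight_nonneg[OF w]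
  define G where "G = (\<Union>x\<in>F. {y. lattice_adj x y})"
  have G: "finite G" unfolding G_def using F finite_neighbours by blast
  have "\<bar>laplacian w f x\<bar> * vertex_measure w x \<le> (\<Sum>y\<in>G. w x y * \<bar>f y\<bar>) + \<bar>f x\<bar> * vertex_measure w x"
    if "x \<in> F" for x
  proof -
    have "\<bar>laplacian w f x\<bar> * vertex_measure w x = \<bar>\<Sum>y | lattice_adj x y. w x y * (f y - f x)\<bar>"
      using pos[of x] by (simp add: laplacian_def abs_mult)
    also have "\<dots> \<le> (\<Sum>y | lattice_adj x y. \<bar>w x y * (f y - f x)\<bar>)"
      by (rule sum_abs)
    also have "\<dots> \<le> (\<Sum>y | lattice_adj x y. w x y * \<bar>f y\<bar> + w x y * \<bar>f x\<bar>)"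
      using nn by (intro sum_mono) (auto simp: abs_mult simp flip: distrib_left intro!: mult_left_mono)
    also have "\<dots> = (\<Sum>y | lattice_adj x y. w x y * \<bar>f y\<bar>) + \<bar>f x\<bar> * vertex_measure w x"
      by (simp add: sum.distrib vertex_measure_def sum_distrib_left mult.commute)
    also have "(\<Sum>y | lattice_adj x y. w x y * \<bar>f y\<bar>) \<le> (\<Sum>y\<in>G. w x y * \<bar>f y\<bar>)"
      using that G nn unfolding G_def by (intro sum_mono2) auto
    finally show ?thesis by simp
  qed
  then have "(\<Sum>x\<in>F. \<bar>laplacian w f x\<bar> * vertex_measure w x)
     \<le> (\<Sum>x\<in>F. (\<Sum>y\<in>G. w x y * \<bar>f y\<bar>) + \<bar>f x\<bar> * vertex_measure w x)"
    by (rule sum_mono)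
  also have "\<dots> = (\<Sum>x\<in>F. \<Sum>y\<in>G. w x y * \<bar>f y\<bar>) + (\<Sum>x\<in>F. \<bar>f x\<bar> * vertex_measure w x)"
    by (rule sum.distrib)
  also have "(\<Sum>x\<in>F. \<Sum>y\<in>G. w x y * \<bar>f y\<bar>) = (\<Sum>y\<in>G. \<bar>f y\<bar> * (\<Sum>x\<in>F. w y x))"
    using w by (subst sum.swap) (simp add: sum_distrib_left mult.commute weighted_lattice_def)
  also have "\<dots> \<le> (\<Sum>y\<in>G. \<bar>f y\<bar> * vertex_measure w y)"
    using sum_weight_le[OF w F] by (intro sum_mono mult_left_mono) auto
  finally show ?thesis using K[OF F] K[OF G] by linarith
qed

lemma laplacian_sup:
  fixes f :: "int ^ 'd::finite \<Rightarrow> real"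
  assumes w: "weighted_lattice w" and M: "\<And>x. \<bar>f x\<bar> \<le> M"
  shows "\<bar>laplacian w f x\<bar> \<le> 2 * M"
proof -
  note pos = vertex_measure_pos[OF w] and nn = weight_nonneg[OF w]
  have "\<bar>laplacian w f x\<bar> * vertex_measure w x = \<bar>\<Sum>y | lattice_adj x y. w x y * (f y - f x)\<bar>"
    using pos[of x] by (simp add: laplacian_def abs_mult)
  also have "\<dots> \<le> (\<Sum>y | lattice_adj x y. \<bar>w x y * (f y - f x)\<bar>)"
    by (rule sum_abs)
  also have "\<dots> \<le> (\<Sum>y | lattice_adj x y. w x y * (2 * M))"
  proof (rule sum_mono)
    fix y
    have "\<bar>f y - f x\<bar> \<le> 2 * M" using M[of x] M[of y] by linarith
    then show "\<bar>w x y * (f y - f x)\<bar> \<le> w x y * (2 * M)"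
      using nn[of x y] by (simp add: abs_mult mult_left_mono)
  qed
  also have "\<dots> = 2 * M * vertex_measure w x"
    by (simp add: vertex_measure_def sum_distrib_left mult.commute)
  finally show ?thesis using pos[of x] by simp
qed

lemma laplacian_iter_bounds:
  fixes w :: "int ^ 'd::finite \<Rightarrow> int ^ 'd \<Rightarrow> real"
  assumes w: "weighted_lattice w"
  shows "\<bar>(laplacian w ^^ n) (indicator {y}) x\<bar> \<le> (2 ^ n :: real)"
    and "finite F \<Longrightarrow> (\<Sum>x\<in>F. \<bar>(laplacian w ^^ n) (indicator {y}) x\<bar> * vertex_measure w x)
           \<le> 2 ^ n * vertex_measure w y"
proof -
  show "\<bar>(laplacian w ^^ n) (indicator {y}) x\<bar> \<le> (2 ^ n :: real)"
    by (induction n arbitrary: x) (auto simp: indicator_def intro!: laplacian_sup[OF w])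
  have "(\<Sum>x\<in>F. \<bar>(laplacian w ^^ n) (indicator {y}) x\<bar> * vertex_measure w x)
           \<le> 2 ^ n * vertex_measure w y" if "finite F" for F
    using that
  proof (induction n arbitrary: F)
    case 0
    have "(\<Sum>x\<in>F. \<bar>indicator {y} x\<bar> * vertex_measure w x) = (\<Sum>x\<in>F. if x = y then vertex_measure w y else 0)"
      by (rule sum.cong) (auto simp: indicator_def)
    then show ?case using 0 vertex_measure_pos[OF w, of y] by (simp add: less_imp_le)
  next
    case (Suc n)
    then show ?case using laplacian_l1[OF w Suc.IH Suc.prems] by simp
  qed
  then show "finite F \<Longrightarrow> (\<Sum>x\<in>F. \<bar>(laplacian w ^^ n) (indicator {y}) x\<bar> * vertex_measure w x)
           \<le> 2 ^ n * vertex_measure w y" .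
qed

definition heat_series ::
    "(int ^ 'd::finite \<Rightarrow> int ^ 'd \<Rightarrow> real) \<Rightarrow> real \<Rightarrow> int ^ 'd \<Rightarrow> int ^ 'd \<Rightarrow> real" where
  "heat_series w t y x = (\<Sum>n. (t ^ n / fact n) * (laplacian w ^^ n) (indicator {y}) x)"

lemma heat_series_summable:
  assumes w: "weighted_lattice w"
  shows "summable (\<lambda>n. \<bar>(t ^ n / fact n) * (laplacian w ^^ n) (indicator {y}) x\<bar> :: real)"
proof (rule summable_comparison_test')
  show "summable (\<lambda>n. (2 * \<bar>t\<bar>) ^ n / fact n :: real)"
    using summable_exp[of "2 * \<bar>t\<bar>"] by (simp add: divide_inverse mult.commute)
  show "norm \<bar>(t ^ n / fact n) * (laplacian w ^^ n) (indicator {y}) x\<bar> \<le> (2 * \<bar>t\<bar>) ^ n / fact n" 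
    if "n \<ge> 0" for n
    using mult_left_mono[OF laplacian_iter_bounds(1)[OF w, of n y x], of "\<bar>t\<bar> ^ n / fact n"]
    by (simp add: abs_mult power_abs power_mult_distrib mult_ac)
qed

lemma heat_series_tail:
  fixes w :: "int ^ 'd::finite \<Rightarrow> int ^ 'd \<Rightarrow> real"
  assumes w: "weighted_lattice w"
  defines "e \<equiv> \<lambda>t N. \<Sum>n. (2 * \<bar>t\<bar>) ^ (n + N) / fact (n + N) :: real"
  shows "finite F \<Longrightarrow> (\<Sum>x\<in>F. (exp_partial w t (indicator {y}) N x - heat_series w t y x)\<^sup>2 * vertex_measure w x)
           \<le> (e t N)\<^sup>2 * vertex_measure w y"
    and "e t \<longlonglongrightarrow> 0"
proof -
  note pos = vertex_measure_pos[OF w]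
  have se: "summable (\<lambda>n. (2 * \<bar>t\<bar>) ^ n / fact n :: real)"
    using summable_exp[of "2 * \<bar>t\<bar>"] by (simp add: divide_inverse mult.commute)
  note se' = summable_ignore_initial_segment[OF se]
  show "e t \<longlonglongrightarrow> 0"
    unfolding e_def using suminf_exist_split2[OF se] by simp
  define a where "a = (\<lambda>x n. (t ^ n / fact n) * (laplacian w ^^ n) (indicator {y}) x)"
  have sa: "summable (\<lambda>n. \<bar>a x n\<bar>)" for x
    unfolding a_def by (rule heat_series_summable[OF w])
  note sa' = summable_ignore_initial_segment[OF sa, where k = N]
  have e0: "e t N \<ge> 0" unfolding e_def by (intro suminf_nonneg se') auto
  have r: "exp_partial w t (indicator {y}) N x - heat_series w t y x = - (\<Sum>n. a x (n + N))" for x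
    using suminf_split_initial_segment[OF summable_rabs_cancel[OF sa[of x]], of N]
    by (simp add: exp_partial_def heat_series_def a_def)
  have r1: "\<bar>\<Sum>n. a x (n + N)\<bar> \<le> (\<Sum>n. \<bar>a x (n + N)\<bar>)" for x
    by (rule summable_rabs[OF sa'])
  have a1: "\<bar>a x n\<bar> \<le> (2 * \<bar>t\<bar>) ^ n / fact n" for x n
    using mult_left_mono[OF laplacian_iter_bounds(1)[OF w, of n y x], of "\<bar>t\<bar> ^ n / fact n"]
    by (simp add: a_def abs_mult power_abs power_mult_distrib mult_ac)
  have r2: "(\<Sum>n. \<bar>a x (n + N)\<bar>) \<le> e t N" for x
    unfolding e_def by (intro suminf_le a1 sa' se')
  show "(\<Sum>x\<in>F. (exp_partial w t (indicator {y}) N x - heat_series w t y x)\<^sup>2 * vertex_measure w x)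
           \<le> (e t N)\<^sup>2 * vertex_measure w y" if F: "finite F"
  proof -
    have "(\<Sum>x\<in>F. (exp_partial w t (indicator {y}) N x - heat_series w t y x)\<^sup>2 * vertex_measure w x)
      \<le> (\<Sum>x\<in>F. e t N * ((\<Sum>n. \<bar>a x (n + N)\<bar>) * vertex_measure w x))"
    proof (rule sum_mono)
      fix x
      have "\<bar>\<Sum>n. a x (n + N)\<bar> * \<bar>\<Sum>n. a x (n + N)\<bar> \<le> e t N * (\<Sum>n. \<bar>a x (n + N)\<bar>)"
        using order_trans[OF r1[of x] r2[of x]] r1[of x] e0 by (intro mult_mono) auto
      then have "(exp_partial w t (indicator {y}) N x - heat_series w t y x)\<^sup>2 \<le> e t N * (\<Sum>n. \<bar>a x (n + N)\<bar>)"
        unfolding r power2_eq_square by simp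
      from mult_right_mono[OF this less_imp_le[OF pos[of x]]] show "(exp_partial w t (indicator {y}) N x - heat_series w t y x)\<^sup>2 * vertex_measure w x
        \<le> e t N * ((\<Sum>n. \<bar>a x (n + N)\<bar>) * vertex_measure w x)"
        by (simp only: mult.assoc)
    qed
    also have "\<dots> = e t N * (\<Sum>x\<in>F. (\<Sum>n. \<bar>a x (n + N)\<bar> * vertex_measure w x))"
      by (simp only: sum_distrib_left suminf_mult2[OF sa'])
    also have "(\<Sum>x\<in>F. (\<Sum>n. \<bar>a x (n + N)\<bar> * vertex_measure w x)) = (\<Sum>n. \<Sum>x\<in>F. \<bar>a x (n + N)\<bar> * vertex_measure w x)"
      by (rule suminf_sum[symmetric]) (intro summable_mult2 sa')
    also have "\<dots> \<le> (\<Sum>n. (2 * \<bar>t\<bar>) ^ (n + N) / fact (n + N) * vertex_measure w y)"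
    proof (rule suminf_le)
      fix n
      have "(\<Sum>x\<in>F. \<bar>a x n\<bar> * vertex_measure w x) \<le> (2 * \<bar>t\<bar>) ^ n / fact n * vertex_measure w y" for n
        using mult_left_mono[OF laplacian_iter_bounds(2)[OF w F, of n y], of "\<bar>t\<bar> ^ n / fact n"]
        by (simp add: a_def abs_mult power_abs power_mult_distrib mult_ac sum_distrib_left)
      then show "(\<Sum>x\<in>F. \<bar>a x (n+N)\<bar> * vertex_measure w x) \<le> (2 * \<bar>t\<bar>) ^ (n+N) / fact (n+N) * vertex_measure w y" .
    qed (intro summable_sum summable_mult2 sa' se')+
    also have "\<dots> = e t N * vertex_measure w y"
      unfolding e_def by (rule suminf_mult2[symmetric, OF se'])
    finally show ?thesis using e0
      by (simp add: power2_eq_square mult.assoc mult_left_mono)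
  qed
qed

lemma l2_iff_bounded:
  assumes w: "weighted_lattice w"
    and K: "\<And>F. finite F \<Longrightarrow> (\<Sum>x\<in>F. (f x)\<^sup>2 * vertex_measure w x) \<le> K"
  shows "l2 w (f :: _ \<Rightarrow> real)" "l2_norm w f \<le> sqrt K"
proof -
  have n: "0 \<le> (norm (f x))\<^sup>2 * vertex_measure w x" for x
    using vertex_measure_pos[OF w, of x] by simp
  show l: "l2 w f" unfolding l2_def
    using n K by (intro nonneg_bdd_above_summable_on) (auto intro!: bdd_aboveI[of _ K])
  show "l2_norm w f \<le> sqrt K" unfolding l2_norm_def real_sqrt_le_iff
    using l K unfolding l2_def by (intro infsum_le_finite_sums) auto
qed

lemma l2_norm_ge:
  assumes w: "weighted_lattice w" and "l2 w f"
  shows "norm (f x) * sqrt (vertex_measure w x) \<le> l2_norm w f"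
proof -
  have n: "0 \<le> (norm (f x))\<^sup>2 * vertex_measure w x" for x
    using vertex_measure_pos[OF w, of x] by simp
  have "(norm (f x))\<^sup>2 * vertex_measure w x \<le> (\<Sum>\<^sub>\<infinity>x. (norm (f x))\<^sup>2 * vertex_measure w x)"
    using finite_sum_le_infsum[of "\<lambda>x. (norm (f x))\<^sup>2 * vertex_measure w x" UNIV "{x}"] assms n
    by (simp add: l2_def)
  from real_sqrt_le_mono[OF this] show ?thesis
    unfolding l2_norm_def by (simp add: real_sqrt_mult)
qed

lemma heat_semigroup_indicator:
  assumes w: "weighted_lattice w"
  shows "heat_semigroup w t (indicator {y}) = heat_series w t y"
  unfolding heat_semigroup_def
proof (rule the_equality, intro conjI allI)
  let ?e = "\<lambda>N. \<Sum>n. (2 * \<bar>t\<bar>) ^ (n + N) / fact (n + N) :: real"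
  note tail = heat_series_tail[OF w]
  show l: "l2 w (\<lambda>x. exp_partial w t (indicator {y}) N x - heat_series w t y x)" for N
    using tail(1) by (intro l2_iff_bounded(1)[OF w])
  have "l2 w (\<lambda>x. - heat_series w t y x)"
    using l[of 0] by (simp add: exp_partial_def)
  then show "l2 w (heat_series w t y)" by (simp add: l2_def)
  show lim: "(\<lambda>N. l2_norm w (\<lambda>x. exp_partial w t (indicator {y}) N x - heat_series w t y x)) \<longlonglongrightarrow> 0"
  proof (rule tendsto_sandwich)
    show "\<forall>\<^sub>F N in sequentially. 0 \<le> l2_norm w (\<lambda>x. exp_partial w t (indicator {y}) N x - heat_series w t y x)"
      using vertex_measure_pos[OF w] by (simp add: l2_norm_def infsum_nonneg less_imp_le)
    show "\<forall>\<^sub>F N in sequentially. l2_norm w (\<lambda>x. exp_partial w t (indicator {y}) N x - heat_series w t y x)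
        \<le> sqrt ((?e N)\<^sup>2 * vertex_measure w y)"
      using tail(1) by (intro always_eventually allI l2_iff_bounded(2)[OF w])
    show "(\<lambda>N. sqrt ((?e N)\<^sup>2 * vertex_measure w y)) \<longlonglongrightarrow> 0"
      by (rule tendsto_eq_intros tail(2) refl | simp)+
  qed simp
  fix v :: "_ \<Rightarrow> real"
  have pw: "(\<lambda>N. exp_partial w t (indicator {y}) N x) \<longlonglongrightarrow> v x"
    if "\<And>N. l2 w (\<lambda>x. exp_partial w t (indicator {y}) N x - v x)"
      "(\<lambda>N. l2_norm w (\<lambda>x. exp_partial w t (indicator {y}) N x - v x)) \<longlonglongrightarrow> 0" for v :: "_ \<Rightarrow> real" and x
  proof -
    let ?s = "sqrt (vertex_measure w x)"
    have s: "?s > 0" using vertex_measure_pos[OF w] by simp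
    have "(\<lambda>N. exp_partial w t (indicator {y}) N x - v x) \<longlonglongrightarrow> 0"
    proof (rule Lim_null_comparison)
      show "\<forall>\<^sub>F N in sequentially. norm (exp_partial w t (indicator {y}) N x - v x)
         \<le> l2_norm w (\<lambda>x. exp_partial w t (indicator {y}) N x - v x) / ?s"
        using l2_norm_ge[OF w that(1), of _ x] s by (intro always_eventually allI) (simp add: pos_le_divide_eq)
      show "(\<lambda>N. l2_norm w (\<lambda>x. exp_partial w t (indicator {y}) N x - v x) / ?s) \<longlonglongrightarrow> 0"
        using tendsto_divide_zero[OF that(2)] .
    qed
    then show ?thesis by (simp add: LIM_zero_iff)
  qed
  assume "l2 w v \<and> (\<forall>N. l2 w (\<lambda>x. exp_partial w t (indicator {y}) N x - v x)) \<and>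
     (\<lambda>N. l2_norm w (\<lambda>x. exp_partial w t (indicator {y}) N x - v x)) \<longlonglongrightarrow> 0"
  then have "v x = heat_series w t y x" for x
    by (intro LIMSEQ_unique[OF pw[of v] pw[OF l lim]]) auto
  then show "v = heat_series w t y" ..
qed

lemma W_log_integrable:
  assumes w: "weighted_lattice w" and xy: "x \<noteq> y"
  shows "set_integrable lborel {0<..1} (\<lambda>t. heat_kernel w t x y / t)"
proof -
  define c where "c = (\<lambda>n. (laplacian w ^^ Suc n) (indicator {y}) x / fact (Suc n) :: real)"
  have sum: "summable (\<lambda>n. (t ^ n / fact n) * (laplacian w ^^ n) (indicator {y}) x :: real)" for t
    by (rule summable_rabs_cancel[OF heat_series_summable[OF w]])
  have *: "(\<lambda>n. t * (c n * t ^ n)) = (\<lambda>n. (t ^ Suc n / fact (Suc n)) * (laplacian w ^^ Suc n) (indicator {y}) x)" for t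
    by (auto simp: c_def field_simps simp del: funpow.simps fact_Suc)
  have sc: "summable (\<lambda>n. c n * t ^ n)" if "t \<noteq> 0" for t
    using summable_Suc_iff[THEN iffD2, OF sum[of t]] that summable_mult_D[of t "\<lambda>n. c n * t ^ n"]
    unfolding * by blast
  have "heat_kernel w t x y / t = (\<Sum>n. c n * t ^ n) / vertex_measure w y" if "t \<noteq> 0" for t
  proof -
    have "heat_series w t y x = t * (\<Sum>n. c n * t ^ n)"
      unfolding heat_series_def suminf_mult[OF sc[OF that], symmetric] *
      using suminf_split_head[OF sum[of t]] xy by (simp add: indicator_def)
    then show ?thesis using that
      by (simp add: heat_kernel_def heat_semigroup_indicator[OF w])
  qed
  moreover have "set_integrable lborel {0<..1} (\<lambda>t. (\<Sum>n. c n * t ^ n) / vertex_measure w y)"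
  proof (rule set_integrable_subset)
    have "isCont (\<lambda>t. \<Sum>n. c n * t ^ n) t" if "t \<in> {0..1}" for t
      using that by (intro isCont_powser[OF sc[of 2]]) auto
    then have "continuous_on {0..1} (\<lambda>t. (\<Sum>n. c n * t ^ n) / vertex_measure w y)"
      using vertex_measure_pos[OF w, of y]
      by (intro continuous_on_divide continuous_at_imp_continuous_on ballI) (auto simp: less_imp_neq[symmetric])
    then show "set_integrable lborel {0..1} (\<lambda>t. (\<Sum>n. c n * t ^ n) / vertex_measure w y)"
      unfolding set_integrable_def by (intro borel_integrable_compact) auto
  qed auto
  ultimately show ?thesis
    by (subst set_integrable_cong[OF refl refl]) auto
qed

end

theory Submission
  imports Defs
begin

text \<open>
  The logarithmic gradient is bounded because its kernel has finite mass. The integrand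
  \<open>p(t,x,y)/t\<close> looks singular at \<open>t = 0\<close>, but for \<open>x \<noteq> y\<close> the exponential series of \<open>e\<^sup>t\<^sup>\<Delta>\<close> has no
  term of order \<open>0\<close>, and for \<open>t \<le> 1\<close> every remaining power \<open>t\<^sup>n\<close> is at most \<open>t\<close>. Hence
  \<open>\<bar>W\<^sub>l\<^sub>o\<^sub>g(x,y)\<bar> \<le> \<mu>(x) S(x,y)\<close> with \<open>S(x,y) = \<Sum>\<^sub>n \<bar>(\<Delta>\<^sup>n 1\<^sub>y)(x)\<bar> / n!\<close> (lemma \<open>abs_W_log_le\<close>).

  On bounded functions, and on \<open>\<ell>\<^sup>1(\<mu>)\<close>, the operator \<open>\<Delta>\<close> has norm at most \<open>2\<close>. The former controls
  \<open>\<Sum>\<^sub>y \<bar>(\<Delta>\<^sup>n 1\<^sub>y)(x)\<bar>\<close>, the latter \<open>\<Sum>\<^sub>x \<mu>(x) \<bar>(\<Delta>\<^sup>n 1\<^sub>y)(x)\<bar>\<close>. So the off-diagonal sums of \<open>\<bar>W\<^sub>l\<^sub>o\<^sub>g\<bar>\<close>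
  over either variable are at most \<open>\<Sum>\<^sub>n 2\<^sup>n/n! = e\<^sup>2\<close> times \<open>\<mu>\<close> of the other one
  (lemmas \<open>W_log_row_sum\<close> and \<open>W_log_column_sum\<close>).

  Finally \<open>\<bar>u(x) - u(y)\<bar>\<^sup>2 \<le> 2 \<bar>u(x)\<bar>\<^sup>2 + 2 \<bar>u(y)\<bar>\<^sup>2\<close> decouples the two variables in
  \<open>\<Sum>\<^sub>x\<^sub>,\<^sub>y \<bar>W\<^sub>l\<^sub>o\<^sub>g(x,y)\<bar> \<bar>u(x) - u(y)\<bar>\<^sup>2 / 2\<close>, and the row and column sums bound this double sum by
  \<open>2 e\<^sup>2 \<parallel>u\<parallel>\<^sup>2\<close>, as in the Schur test (lemma \<open>schur_double_sum\<close>).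
\<close>

lemma laplacian_linear_combination:
  fixes f :: "'b \<Rightarrow> int ^ 'd::finite \<Rightarrow> real"
  shows "laplacian w (\<lambda>z. \<Sum>i\<in>F. c i * f i z) x = (\<Sum>i\<in>F. c i * laplacian w (f i) x)"
proof -
  have "(\<Sum>y | lattice_adj x y. w x y * ((\<Sum>i\<in>F. c i * f i y) - (\<Sum>i\<in>F. c i * f i x)))
      = (\<Sum>y | lattice_adj x y. \<Sum>i\<in>F. c i * (w x y * (f i y - f i x)))"
    by (simp add: sum_subtractf[symmetric] sum_distrib_left algebra_simps)
  also have "\<dots> = (\<Sum>i\<in>F. c i * (\<Sum>y | lattice_adj x y. w x y * (f i y - f i x)))"
    by (subst sum.swap) (simp add: sum_distrib_left)
  finally show ?thesis
    by (simp add: laplacian_def sum_divide_distrib[where A = F])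
qed

text \<open>
  Duality turns the bound of \<open>\<Delta>\<close> on bounded functions into a bound for families: choosing signs that
  make every \<open>\<Delta> f\<^sub>i(x)\<close> nonnegative reduces the sum of absolute values to a single function.
\<close>

lemma laplacian_family_sup:
  fixes f :: "'b \<Rightarrow> int ^ 'd::finite \<Rightarrow> real"
  assumes w: "weighted_lattice w" and M: "\<And>z. (\<Sum>i\<in>F. \<bar>f i z\<bar>) \<le> M"
  shows "(\<Sum>i\<in>F. \<bar>laplacian w (f i) x\<bar>) \<le> 2 * M"
proof -
  define c where "c i = sgn (laplacian w (f i) x)" for i
  have "\<bar>\<Sum>i\<in>F. c i * f i z\<bar> \<le> M" for z
  proof -
    have "\<bar>\<Sum>i\<in>F. c i * f i z\<bar> \<le> (\<Sum>i\<in>F. \<bar>c i * f i z\<bar>)" by (rule sum_abs)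
    also have "\<dots> \<le> (\<Sum>i\<in>F. \<bar>f i z\<bar>)"
      by (rule sum_mono) (simp add: c_def abs_mult abs_sgn_eq)
    finally show ?thesis using M[of z] by simp
  qed
  from laplacian_sup[where f = "\<lambda>z. \<Sum>i\<in>F. c i * f i z" and x = x, OF w this]
  have "\<bar>\<Sum>i\<in>F. c i * laplacian w (f i) x\<bar> \<le> 2 * M"
    by (simp only: laplacian_linear_combination)
  moreover have "c i * laplacian w (f i) x = \<bar>laplacian w (f i) x\<bar>" for i
    by (simp add: c_def abs_sgn mult.commute)
  ultimately show ?thesis by simp
qed

lemma laplacian_iter_row_sum:
  fixes w :: "int ^ 'd::finite \<Rightarrow> int ^ 'd \<Rightarrow> real"
  assumes w: "weighted_lattice w" and F: "finite F"
  shows "(\<Sum>y\<in>F. \<bar>(laplacian w ^^ n) (indicator {y}) x\<bar>) \<le> (2 ^ n :: real)"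
proof (induction n arbitrary: x)
  case 0
  have "(\<Sum>y\<in>F. \<bar>indicator {y} x\<bar>) = (\<Sum>y\<in>F. if y = x then 1 else (0::real))"
    by (rule sum.cong) (auto simp: indicator_def)
  then show ?case using F by simp
next
  case (Suc n)
  show ?case using laplacian_family_sup[OF w Suc.IH] by simp
qed

text \<open>The function \<open>S\<close>: the series of \<open>e\<^sup>\<Delta> 1\<^sub>y\<close> at \<open>x\<close>, with absolute values inside so that it can serve as a majorant.\<close>

definition abs_heat_series ::
    "(int ^ 'd::finite \<Rightarrow> int ^ 'd \<Rightarrow> real) \<Rightarrow> int ^ 'd \<Rightarrow> int ^ 'd \<Rightarrow> real" where
  "abs_heat_series w x y = (\<Sum>n. \<bar>(laplacian w ^^ n) (indicator {y}) x\<bar> / fact n)"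

lemma abs_heat_series_summable:
  assumes "weighted_lattice w"
  shows "summable (\<lambda>n. \<bar>(laplacian w ^^ n) (indicator {y}) x\<bar> / fact n :: real)"
  using heat_series_summable[OF assms, of 1 y x] by (simp add: abs_mult)

lemma exp_two_sums: "(\<lambda>n. 2 ^ n / fact n) sums (exp 2 :: real)"
  using exp_converges[of "2::real"] by (simp add: divide_inverse mult.commute)

lemma abs_heat_series_row_sum:
  assumes w: "weighted_lattice w" and F: "finite F"
  shows "(\<Sum>y\<in>F. abs_heat_series w x y) \<le> exp 2"
proof -
  note s = abs_heat_series_summable[OF w]
  have "(\<Sum>y\<in>F. abs_heat_series w x y)
      = (\<Sum>n. \<Sum>y\<in>F. \<bar>(laplacian w ^^ n) (indicator {y}) x\<bar> / fact n)"
    unfolding abs_heat_series_def by (rule suminf_sum[symmetric, OF s])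
  also have "\<dots> \<le> (\<Sum>n. 2 ^ n / fact n)"
    using laplacian_iter_row_sum[OF w F]
    by (intro suminf_le summable_sum s sums_summable[OF exp_two_sums])
       (simp add: sum_divide_distrib[symmetric] divide_right_mono)
  finally show ?thesis by (simp add: sums_unique[OF exp_two_sums])
qed

lemma abs_heat_series_column_sum:
  assumes w: "weighted_lattice w" and F: "finite F"
  shows "(\<Sum>x\<in>F. vertex_measure w x * abs_heat_series w x y) \<le> exp 2 * vertex_measure w y"
proof -
  note s = abs_heat_series_summable[OF w]
  let ?a = "\<lambda>x n. vertex_measure w x * (\<bar>(laplacian w ^^ n) (indicator {y}) x\<bar> / fact n)"
  have "(\<Sum>x\<in>F. vertex_measure w x * abs_heat_series w x y) = (\<Sum>x\<in>F. \<Sum>n. ?a x n)"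
    unfolding abs_heat_series_def by (simp only: suminf_mult[OF s])
  also have "\<dots> = (\<Sum>n. \<Sum>x\<in>F. ?a x n)"
    by (rule suminf_sum[symmetric]) (intro summable_mult s)
  also have "\<dots> \<le> (\<Sum>n. 2 ^ n / fact n * vertex_measure w y)"
  proof (rule suminf_le)
    fix n
    have "(\<Sum>x\<in>F. ?a x n)
        = (\<Sum>x\<in>F. \<bar>(laplacian w ^^ n) (indicator {y}) x\<bar> * vertex_measure w x) / fact n"
      by (simp add: sum_divide_distrib mult.commute)
    also have "\<dots> \<le> 2 ^ n * vertex_measure w y / fact n"
      using laplacian_iter_bounds(2)[OF w F] by (intro divide_right_mono) auto
    finally show "(\<Sum>x\<in>F. ?a x n) \<le> 2 ^ n / fact n * vertex_measure w y" by simp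
  qed (intro summable_sum summable_mult summable_mult2 s sums_summable[OF exp_two_sums])+
  also have "\<dots> = exp 2 * vertex_measure w y"
    by (rule sums_unique[symmetric]) (intro sums_mult2 exp_two_sums)
  finally show ?thesis .
qed

text \<open>Off the diagonal the series starts at \<open>n = 1\<close>, which gains the factor \<open>t\<close>.\<close>

lemma abs_heat_series_bound:
  assumes w: "weighted_lattice w" and xy: "x \<noteq> y" and t: "0 < t" "t \<le> 1"
  shows "\<bar>heat_series w t y x\<bar> \<le> t * abs_heat_series w x y"
proof -
  let ?b = "\<lambda>n. (laplacian w ^^ n) (indicator {y}) x :: real"
  note s = abs_heat_series_summable[OF w, of y x]
  have "\<bar>heat_series w t y x\<bar> \<le> (\<Sum>n. \<bar>(t ^ n / fact n) * ?b n\<bar>)"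
    unfolding heat_series_def by (rule summable_rabs[OF heat_series_summable[OF w]])
  also have "\<dots> \<le> (\<Sum>n. t * (\<bar>?b n\<bar> / fact n))"
  proof (intro suminf_le heat_series_summable[OF w] summable_mult s)
    fix n
    show "\<bar>(t ^ n / fact n) * ?b n\<bar> \<le> t * (\<bar>?b n\<bar> / fact n)"
    proof (cases n)
      case 0
      then show ?thesis using xy by simp
    next
      case (Suc m)
      then have "t ^ n \<le> t" using t by (simp add: mult_left_le power_le_one)
      then have "t ^ n * (\<bar>?b n\<bar> / fact n) \<le> t * (\<bar>?b n\<bar> / fact n)"
        by (rule mult_right_mono) simp
      then show ?thesis using t by (simp add: abs_mult)
    qed
  qed
  also have "\<dots> = t * abs_heat_series w x y"
    unfolding abs_heat_series_def by (rule suminf_mult[OF s])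
  finally show ?thesis .
qed

lemma abs_W_log_le:
  assumes w: "weighted_lattice w" and xy: "x \<noteq> y"
  shows "\<bar>W_log w x y\<bar> \<le> vertex_measure w x * abs_heat_series w x y"
proof -
  note pos = vertex_measure_pos[OF w]
  let ?I = "LINT t:{0<..1}|lborel. heat_kernel w t x y / t"
  define c where "c = abs_heat_series w x y / vertex_measure w y"
  have c: "\<bar>heat_kernel w t x y / t\<bar> \<le> c" if "t \<in> {0<..1}" for t
  proof -
    have "\<bar>heat_series w t y x\<bar> / t \<le> abs_heat_series w x y"
      using abs_heat_series_bound[OF w xy, of t] that by (simp add: pos_divide_le_eq mult.commute)
    then have "\<bar>heat_series w t y x\<bar> / t / vertex_measure w y \<le> c"
      unfolding c_def using pos[of y] by (intro divide_right_mono) auto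
    then show ?thesis
      using that pos[of y] by (simp add: heat_kernel_def heat_semigroup_indicator[OF w] mult.commute)
  qed
  have const: "set_integrable lborel {0<..1::real} (\<lambda>_. k)" "(LINT t:{0<..1::real}|lborel. k) = k" for k :: real
    by (simp_all add: set_integrable_def set_lebesgue_integral_def)
  note int = W_log_integrable[OF w xy]
  have two_sided: "heat_kernel w t x y / t \<le> c" "- c \<le> heat_kernel w t x y / t" if "t \<in> {0<..1}" for t
    using c[OF that] by linarith+
  have "?I \<le> c"
    using set_integral_mono[OF int const(1) two_sided(1)] by (simp only: const)
  moreover have "- c \<le> ?I"
    using set_integral_mono[OF const(1) int two_sided(2)] by (simp only: const)
  ultimately have "\<bar>?I\<bar> \<le> c" by simp
  then have "vertex_measure w x * vertex_measure w y * \<bar>?I\<bar> \<le> vertex_measure w x * vertex_measure w y * c"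
    using pos[of x] pos[of y] by (intro mult_left_mono) auto
  then show ?thesis
    using pos[of x] pos[of y] by (simp add: W_log_def c_def abs_mult)
qed

lemma W_log_row_sum:
  assumes w: "weighted_lattice w" and F: "finite F"
  shows "(\<Sum>y\<in>F - {x}. \<bar>W_log w x y\<bar>) \<le> exp 2 * vertex_measure w x"
proof -
  have "(\<Sum>y\<in>F - {x}. \<bar>W_log w x y\<bar>) \<le> (\<Sum>y\<in>F - {x}. vertex_measure w x * abs_heat_series w x y)"
    by (intro sum_mono abs_W_log_le[OF w]) auto
  also have "\<dots> = vertex_measure w x * (\<Sum>y\<in>F - {x}. abs_heat_series w x y)"
    by (simp add: sum_distrib_left)
  also have "\<dots> \<le> vertex_measure w x * exp 2"
    using F vertex_measure_pos[OF w, of x]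
    by (intro mult_left_mono abs_heat_series_row_sum[OF w]) auto
  finally show ?thesis by (simp add: mult.commute)
qed

lemma W_log_column_sum:
  assumes w: "weighted_lattice w" and F: "finite F"
  shows "(\<Sum>x\<in>F - {y}. \<bar>W_log w x y\<bar>) \<le> exp 2 * vertex_measure w y"
proof -
  have "(\<Sum>x\<in>F - {y}. \<bar>W_log w x y\<bar>) \<le> (\<Sum>x\<in>F - {y}. vertex_measure w x * abs_heat_series w x y)"
    by (intro sum_mono abs_W_log_le[OF w]) auto
  also have "\<dots> \<le> exp 2 * vertex_measure w y"
    using F by (intro abs_heat_series_column_sum[OF w]) auto
  finally show ?thesis .
qed

text \<open>
  The form in which the Schur test is used here: each of the two summands of \<open>f x + f y\<close> can be summed
  first over the variable on which it does not depend, which costs a factor \<open>A m\<close>.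
\<close>

lemma schur_double_sum:
  fixes K :: "'b \<Rightarrow> 'b \<Rightarrow> real" and f m :: "'b \<Rightarrow> real"
  assumes K: "\<And>x y. K x y \<ge> 0" and f: "\<And>x. f x \<ge> 0" and m: "\<And>x. m x \<ge> 0" and A: "A \<ge> 0"
    and row: "\<And>x F. finite F \<Longrightarrow> (\<Sum>y\<in>F. K x y) \<le> A * m x"
    and col: "\<And>y F. finite F \<Longrightarrow> (\<Sum>x\<in>F. K x y) \<le> A * m y"
    and fm: "(\<lambda>x. f x * m x) summable_on UNIV"
  shows "(\<lambda>(x, y). K x y * (f x + f y)) summable_on UNIV" (is "?g summable_on _")
    and "(\<Sum>\<^sub>\<infinity>(x, y). K x y * (f x + f y)) \<le> 2 * A * (\<Sum>\<^sub>\<infinity>x. f x * m x)"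
proof -
  let ?T = "\<Sum>\<^sub>\<infinity>x. f x * m x"
  have half: "(\<Sum>x\<in>G. f x * (\<Sum>y\<in>G. L x y)) \<le> A * ?T"
    if G: "finite G" and L: "\<And>x. (\<Sum>y\<in>G. L x y) \<le> A * m x" for G and L :: "'b \<Rightarrow> 'b \<Rightarrow> real"
  proof -
    have "(\<Sum>x\<in>G. f x * (\<Sum>y\<in>G. L x y)) \<le> (\<Sum>x\<in>G. f x * (A * m x))"
      using L f by (intro sum_mono mult_left_mono) auto
    also have "\<dots> = A * (\<Sum>x\<in>G. f x * m x)"
      by (simp add: sum_distrib_left mult_ac)
    also have "\<dots> \<le> A * ?T"
      using f m A G by (intro mult_left_mono finite_sum_le_infsum[OF fm]) auto
    finally show ?thesis .
  qed
  have bound: "sum ?g F \<le> 2 * A * ?T" if F: "finite F" for F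
  proof -
    define G where "G = fst ` F \<union> snd ` F"
    have G: "finite G" and FG: "F \<subseteq> G \<times> G"
      using F by (auto simp: G_def intro: rev_image_eqI)
    have "sum ?g F \<le> sum ?g (G \<times> G)"
      using FG G K f by (intro sum_mono2) auto
    also have "\<dots> = (\<Sum>x\<in>G. \<Sum>y\<in>G. K x y * f x) + (\<Sum>x\<in>G. \<Sum>y\<in>G. K x y * f y)"
      by (simp add: sum.cartesian_product[symmetric] distrib_left sum.distrib)
    also have "(\<Sum>x\<in>G. \<Sum>y\<in>G. K x y * f y) = (\<Sum>y\<in>G. \<Sum>x\<in>G. K x y * f y)"
      by (rule sum.swap)
    also have "(\<Sum>x\<in>G. \<Sum>y\<in>G. K x y * f x) + \<dots>
        = (\<Sum>x\<in>G. f x * (\<Sum>y\<in>G. K x y)) + (\<Sum>y\<in>G. f y * (\<Sum>x\<in>G. K x y))"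
      by (simp add: sum_distrib_left mult.commute)
    also have "\<dots> \<le> A * ?T + A * ?T"
      using half[OF G, of K] half[OF G, of "\<lambda>x y. K y x"] row[OF G] col[OF G] by (intro add_mono) auto
    finally show ?thesis by simp
  qed
  show s: "?g summable_on UNIV"
    using K f bound by (intro nonneg_bdd_above_summable_on) (auto intro!: bdd_aboveI[of _ "2 * A * ?T"])
  show "infsum ?g UNIV \<le> 2 * A * ?T"
    using bound by (intro infsum_le_finite_sums[OF s])
qed

text \<open>
  The real function \<open>sqrt\<close> is odd, so the square of a component of the gradient contains
  \<open>\<bar>W\<^sub>l\<^sub>o\<^sub>g\<bar>\<close> whatever the sign of \<open>W\<^sub>l\<^sub>o\<^sub>g\<close> is.
\<close>

lemma grad_log_square_le:
  fixes u :: "int ^ 'd::finite \<Rightarrow> 'a::real_normed_vector"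
  assumes w: "weighted_lattice w"
  shows "(norm (grad_log w u x y))\<^sup>2 * vertex_measure w x
    \<le> \<bar>W_log w x y\<bar> * ((norm (u x))\<^sup>2 + (norm (u y))\<^sup>2)"
proof -
  note pos = vertex_measure_pos[OF w, of x]
  have sq: "(sqrt r)\<^sup>2 = \<bar>r\<bar>" for r
    by (simp add: power2_eq_square)
  have "(norm (u x - u y))\<^sup>2 \<le> (norm (u x) + norm (u y))\<^sup>2"
    by (intro power_mono norm_triangle_ineq4) auto
  also have "\<dots> \<le> 2 * ((norm (u x))\<^sup>2 + (norm (u y))\<^sup>2)"
    using sum_squares_bound[of "norm (u x)" "norm (u y)"] by (simp add: power2_sum)
  finally have "\<bar>W_log w x y\<bar> / 2 * (norm (u x - u y))\<^sup>2
      \<le> \<bar>W_log w x y\<bar> / 2 * (2 * ((norm (u x))\<^sup>2 + (norm (u y))\<^sup>2))"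
    by (rule mult_left_mono) simp
  moreover have "(norm (grad_log w u x y))\<^sup>2 * vertex_measure w x
      = \<bar>W_log w x y\<bar> / 2 * (norm (u x - u y))\<^sup>2"
    using pos by (simp add: grad_log_def power_mult_distrib sq power2_abs)
  ultimately show ?thesis by (simp add: algebra_simps)
qed

lemma grad_log_bounded:
  fixes u :: "int ^ 'd::finite \<Rightarrow> 'a::real_normed_vector"
  assumes w: "weighted_lattice w" and u: "l2 w u"
  shows "grad_log_l2 w u" and "l2_norm w (grad_log_length w u) \<le> sqrt (2 * exp 2) * l2_norm w u"
proof -
  note pos = vertex_measure_pos[OF w]
  define K where "K x y = (if x = y then 0 else \<bar>W_log w x y\<bar>)" for x y
  define f where "f x = (norm (u x))\<^sup>2" for x
  define g where "g x y = (norm (grad_log w u x y))\<^sup>2 * vertex_measure w x" for x y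
  have K_row: "(\<Sum>y\<in>F. K x y) \<le> exp 2 * vertex_measure w x"
    and K_col: "(\<Sum>y\<in>F. K y x) \<le> exp 2 * vertex_measure w x" if "finite F" for x F
  proof -
    have "(\<Sum>y\<in>F. K x y) = (\<Sum>y\<in>F - {x}. \<bar>W_log w x y\<bar>)"
      and "(\<Sum>y\<in>F. K y x) = (\<Sum>y\<in>F - {x}. \<bar>W_log w y x\<bar>)"
      using that by (auto simp: K_def intro!: sum.mono_neutral_cong_right split: if_splits)
    then show "(\<Sum>y\<in>F. K x y) \<le> exp 2 * vertex_measure w x"
      and "(\<Sum>y\<in>F. K y x) \<le> exp 2 * vertex_measure w x"
      using W_log_row_sum[OF w that] W_log_column_sum[OF w that] by auto
  qed
  have fm: "(\<lambda>x. f x * vertex_measure w x) summable_on UNIV"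
    using u by (simp add: l2_def f_def)
  have K0: "K x y \<ge> 0" and f0: "f x \<ge> 0" and m0: "vertex_measure w x \<ge> 0" and g0: "g x y \<ge> 0" for x y
    using pos[of x] by (auto simp: K_def f_def g_def)
  note schur = schur_double_sum[of K f "vertex_measure w" "exp 2", OF K0 f0 m0 _ K_row K_col fm, simplified]
  let ?D = "Sigma UNIV (\<lambda>x. - {x})"
  have g_le: "g x y \<le> K x y * (f x + f y)" if "y \<noteq> x" for x y
    using grad_log_square_le[OF w, of u x y] that by (auto simp: g_def K_def f_def)
  have gD: "(\<lambda>(x, y). g x y) summable_on ?D"
    using g_le g0
    by (intro summable_on_comparison_test[OF summable_on_subset_banach[OF schur(1)]]) auto
  have g_row: "g x summable_on - {x}" for x
    using summable_on_SigmaD1[OF gD] by simp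
  have row: "(\<lambda>y. (norm (grad_log w u x y))\<^sup>2) summable_on - {x}" for x
    using summable_on_cmult_left[OF g_row[of x], of "1 / vertex_measure w x"] pos[of x]
    by (simp add: g_def)
  have len: "(norm (grad_log_length w u x))\<^sup>2 * vertex_measure w x = (\<Sum>\<^sub>\<infinity>y\<in>- {x}. g x y)" for x
  proof -
    have "(norm (grad_log_length w u x))\<^sup>2 = (\<Sum>\<^sub>\<infinity>y\<in>- {x}. (norm (grad_log w u x y))\<^sup>2)"
      by (simp add: grad_log_length_def infsum_nonneg)
    then show ?thesis
      using row[of x] by (simp add: g_def infsum_cmult_left)
  qed
  have "l2 w (grad_log_length w u)"
    unfolding l2_def len using gD by (rule summable_on_Sigma_banach)
  then show "grad_log_l2 w u"
    using row by (simp add: grad_log_l2_def)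
  have "(\<Sum>\<^sub>\<infinity>x. (norm (grad_log_length w u x))\<^sup>2 * vertex_measure w x) = (\<Sum>\<^sub>\<infinity>(x, y)\<in>?D. g x y)"
    unfolding len using gD by (rule infsum_Sigma'_banach)
  also have "\<dots> \<le> (\<Sum>\<^sub>\<infinity>(x, y). K x y * (f x + f y))"
    using g_le K0 f0 by (intro infsum_mono_neutral[OF gD schur(1)]) auto
  also have "\<dots> \<le> 2 * exp 2 * (\<Sum>\<^sub>\<infinity>x. f x * vertex_measure w x)"
    by (rule schur(2))
  finally show "l2_norm w (grad_log_length w u) \<le> sqrt (2 * exp 2) * l2_norm w u"
    unfolding l2_norm_def f_def real_sqrt_mult[symmetric] by (rule real_sqrt_le_mono)
qed

theorem proposition1p4:
  fixes w :: "int ^ 'd::finite \<Rightarrow> int ^ 'd \<Rightarrow> real"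
  assumes "weighted_lattice w"
    and "0 < mu_min w" and "mu_min w \<le> mu_max w" and "mu_max w < \<infinity>"
    and "0 < weight_inf w"
  shows "\<exists>C>0. \<forall>u :: int ^ 'd \<Rightarrow> 'a::real_normed_field. l2 w u \<longrightarrow>
           grad_log_l2 w u \<and> l2_norm w (grad_log_length w u) \<le> C * l2_norm w u"
  using grad_log_bounded[OF assms(1)] by (intro exI[of _ "sqrt (2 * exp 2)"]) auto

end
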